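(* Let $\epsilon>0$, let $N>0$ be an integer, let $0=x_0<x_1<\dots<x_N=1$ be a partition of $[0,1]$ with $h_i=x_{i+1}-x_i$, and let $u_h\in V_h$ be the linear finite element approximation, i.e. the unique $u_h\in V_h$ with $\epsilon\,(u_h',v_h')+(u_h',v_h)=(1,v_h)$ for all $v_h\in V_h$. For $i=1,\dots,N-1$ define $$W_i^{[2]}=\begin{pmatrix}\frac{1}{h_{i-1}}\\ \frac{1}{h_{i-1}}+\frac{1}{h_i}\\ \frac{1}{h_i}\end{pmatrix}\in\mathbb{R}^{3\times 1},\qquad b_i^{[2]}=\begin{pmatrix}\frac{-x_{i-1}}{h_{i-1}}\\ -x_i\left(\frac{1}{h_{i-1}}+\frac{1}{h_i}\right)\\ \frac{-x_{i+1}}{h_i}\end{pmatrix}\in\mathbb{R}^3,\qquad W_i^{[3]}=\begin{pmatrix}1,&-1,&1\end{pmatrix}\in\mathbb{R}^{1\times 3}.$$ Let $W^{[2]}\in\mathbb{R}^{3(N-1)\times 1}$ and $b^{[2]}\in\mathbb{R}^{3(N-1)}$ be obtained by stacking vertically the blocks $W_1^{[2]},\dots,W_{N-1}^{[2]}$ and $b_1^{[2]},\dots,b_{N-1}^{[2]}$, respectively, and let $$W^{[3]}=\begin{pmatrix}u_h(x_1)\,W_1^{[3]},&\dots,&u_h(x_i)\,W_i^{[3]},&\dots,&u_h(x_{N-1})\,W_{N-1}^{[3]}\end{pmatrix}\in\mathbb{R}^{1\times 3(N-1)}$$ be the row vector obtained by concatenating the scaled blocks. Let $F:\mathbb{R}\to\mathbb{R}$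 be the three-layer neural network $F(x)=W^{[3]}\sigma(W^{[2]}x+b^{[2]})$. Then $F\equiv u_h$, that is, $F(x)=u_h(x)$ for all $x\in[0,1]$.
   Context: $\sigma$ is the ReLU activation function, $\sigma(t)=t$ for $t\ge 0$ and $\sigma(t)=0$ for $t<0$, applied componentwise to vectors. $(\cdot,\cdot)$ is the $L^2(0,1)$ inner product. $V_h$ is the linear finite element space of continuous functions on $[0,1]$ that are piecewise linear with respect to the partition $\{x_0,\dots,x_N\}$ (affine on each $[x_i,x_{i+1}]$) and vanish at $x=0$ and $x=1$. The function $u_h$ is the Galerkin approximation of the boundary value problem $-\epsilon u''+u'=1$ on $(0,1)$, $u(0)=u(1)=0$; it exists and is unique. *)

theory Defs
  imports "HOL-Analysis.Analysis" "Jordan_Normal_Form.Matrix"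
begin

definition is_partition :: "nat \<Rightarrow> (nat \<Rightarrow> real) \<Rightarrow> bool" where
  "is_partition N x \<longleftrightarrow> x 0 = 0 \<and> x N = 1 \<and> (\<forall>i<N. x i < x (i + 1))"

definition mesh :: "(nat \<Rightarrow> real) \<Rightarrow> nat \<Rightarrow> real" where
  "mesh x i = x (i + 1) - x i"

text \<open>Functions on \<open>[0,1]\<close> are represented by total functions, whose values outside
  \<open>[0,1]\<close> are irrelevant. Elements of \<open>fem_space\<close> are thus to be compared on \<open>[0,1]\<close> only.\<close>

definition fem_space :: "nat \<Rightarrow> (nat \<Rightarrow> real) \<Rightarrow> (real \<Rightarrow> real) set" where
  "fem_space N x = {v. continuous_on {0..1} v
     \<and> (\<forall>i<N. \<exists>a b. \<forall>t\<in>{x i..x (i + 1)}. v t = a * t + b)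
     \<and> v 0 = 0 \<and> v 1 = 0}"

definition L2_inner :: "(real \<Rightarrow> real) \<Rightarrow> (real \<Rightarrow> real) \<Rightarrow> real" where
  "L2_inner f g = (LINT t:{0<..<1}|lborel. f t * g t)"

text \<open>For a function in \<open>fem_space\<close>, \<open>deriv\<close> agrees with the weak derivative on \<open>(0,1)\<close> except
  possibly at the nodes, which form a null set; its value there does not affect the integrals.\<close>

definition galerkin_solution :: "real \<Rightarrow> nat \<Rightarrow> (nat \<Rightarrow> real) \<Rightarrow> (real \<Rightarrow> real) \<Rightarrow> bool" where
  "galerkin_solution \<epsilon> N x u \<longleftrightarrow> u \<in> fem_space N x
     \<and> (\<forall>v\<in>fem_space N x.
          \<epsilon> * L2_inner (deriv u) (deriv v) + L2_inner (deriv u) v = L2_inner (\<lambda>t. 1) v)"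

definition relu :: "real \<Rightarrow> real" where
  "relu t = (if t \<ge> 0 then t else 0)"

text \<open>The layers are input, hidden and output; input and output are vectors of dimension 1,
  identified with real numbers.\<close>

definition three_layer_network ::
    "real Matrix.mat \<Rightarrow> real Matrix.vec \<Rightarrow> real Matrix.mat \<Rightarrow> real \<Rightarrow> real" where
  "three_layer_network W2 b2 W3 t =
     vec_index (W3 *\<^sub>v map_vec relu (W2 *\<^sub>v vec_of_list [t] + b2)) 0"

definition append_cols :: "real Matrix.mat \<Rightarrow> real Matrix.mat \<Rightarrow> real Matrix.mat" where
  "append_cols A B = four_block_mat A B (0\<^sub>m 0 (dim_col A)) (0\<^sub>m 0 (dim_col B))"

definition W2_block :: "(nat \<Rightarrow> real) \<Rightarrow> nat \<Rightarrow> real Matrix.mat" where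
  "W2_block x i = mat_of_rows_list 1
     [[1 / mesh x (i - 1)],
      [1 / mesh x (i - 1) + 1 / mesh x i],
      [1 / mesh x i]]"

definition b2_block :: "(nat \<Rightarrow> real) \<Rightarrow> nat \<Rightarrow> real Matrix.vec" where
  "b2_block x i = vec_of_list
     [- x (i - 1) / mesh x (i - 1),
      - x i * (1 / mesh x (i - 1) + 1 / mesh x i),
      - x (i + 1) / mesh x i]"

definition W3_block :: "real Matrix.mat" where
  "W3_block = mat_of_rows_list 3 [[1, -1, 1]]"

text \<open>The blocks are indexed by \<open>1, \<dots>, N - 1\<close>; for \<open>N = 1\<close> the hidden layer has width 0.\<close>

definition W2_mat :: "nat \<Rightarrow> (nat \<Rightarrow> real) \<Rightarrow> real Matrix.mat" where
  "W2_mat N x = foldr append_rows (map (W2_block x) [1..<N]) (0\<^sub>m 0 1)"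

definition b2_vec :: "nat \<Rightarrow> (nat \<Rightarrow> real) \<Rightarrow> real Matrix.vec" where
  "b2_vec N x = foldr append_vec (map (b2_block x) [1..<N]) (0\<^sub>v 0)"

definition W3_mat :: "nat \<Rightarrow> (nat \<Rightarrow> real) \<Rightarrow> (real \<Rightarrow> real) \<Rightarrow> real Matrix.mat" where
  "W3_mat N x u = foldr append_cols (map (\<lambda>i. u (x i) \<cdot>\<^sub>m W3_block) [1..<N]) (0\<^sub>m 1 0)"

end

theory Submission
  imports Defs
begin

text \<open>The three neurons of block \<open>i\<close>, read out with the weights \<open>1, -1, 1\<close>, produce
  the nodal basis function (hat function) of the node \<open>x i\<close>: their kinks lie at \<open>x (i - 1)\<close>,
  \<open>x i\<close>, \<open>x (i + 1)\<close>, and the slope jumps there, \<open>1 / h\<close>, \<open>-(1 / h + 1 / h')\<close> and \<open>1 / h'\<close> for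
  the adjacent mesh widths \<open>h\<close> and \<open>h'\<close>, are those of the function that rises from 0 to 1,
  returns to 0 and stays there (\<open>hat_net_on_cell\<close>).

  Stacking weights and biases vertically and output weights horizontally puts networks side by
  side and adds their outputs, and scaling the output weights scales the output. Hence the whole
  network computes \<open>\<Sum>i. u (x i) * hat i\<close> with \<open>i\<close> ranging over the interior nodes
  (\<open>stacked_network\<close>), which is the continuous piecewise linear interpolant of the nodal values
  with value 0 at both ends of the interval. Now \<open>u\<^sub>h\<close> is itself piecewise linear on the
  partition and vanishes at 0 and 1, so it equals this interpolant (\<open>sum_hat_net_eq\<close>).\<close>

section \<open>Networks side by side\<close>

text \<open>The activation acts componentwise, so the two groups of hidden neurons do not interact;
  the output neuron adds up what it receives from each group.\<close>

lemma network_parallel: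
  assumes A: "A \<in> carrier_mat m 1" "A' \<in> carrier_mat m' 1"
    and b: "b \<in> carrier_vec m" "b' \<in> carrier_vec m'"
    and C: "C \<in> carrier_mat 1 m" "C' \<in> carrier_mat 1 m'"
  shows "three_layer_network (A @\<^sub>r A') (b @\<^sub>v b') (append_cols C C') t =
    three_layer_network A b C t + three_layer_network A' b' C' t"
proof -
  define s where "s = vec_of_list [t]"
  have s: "s \<in> carrier_vec 1"
    by (rule carrier_vecI) (simp add: s_def)
  define z z' where "z = A *\<^sub>v s" and "z' = A' *\<^sub>v s"
  have z: "z \<in> carrier_vec m" "z' \<in> carrier_vec m'"
    unfolding z_def z'_def by (rule mult_mat_vec_carrier[OF A(1) s] mult_mat_vec_carrier[OF A(2) s])+
  define y y' where "y = map_vec relu (z + b)" and "y' = map_vec relu (z' + b')"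
  have y: "y \<in> carrier_vec m" "y' \<in> carrier_vec m'"
    using carrier_vecD[OF b(1)] carrier_vecD[OF b(2)]
    by (auto simp: y_def y'_def intro!: carrier_vecI)
  have "(A @\<^sub>r A') *\<^sub>v s + (b @\<^sub>v b') = (z + b) @\<^sub>v (z' + b')"
    unfolding mat_mult_append[OF A s] z_def[symmetric] z'_def[symmetric]
    by (rule append_vec_add[OF z(1) b(1) z(2) b(2)])
  moreover have "map_vec relu (v @\<^sub>v w) = map_vec relu v @\<^sub>v map_vec relu w" for v w
    by (rule eq_vecI) simp_all
  ultimately have hidden: "map_vec relu ((A @\<^sub>r A') *\<^sub>v s + (b @\<^sub>v b')) = y @\<^sub>v y'"
    by (simp only: y_def y'_def)
  have dims: "dim_col C = m" "dim_col C' = m'" "dim_row C = 1" "dim_row C' = 1"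
    using carrier_matD[OF C(1)] carrier_matD[OF C(2)] by simp_all
  \<comment> \<open>\<open>append_cols\<close> is a block matrix whose lower blocks have no rows; they contribute an empty
    vector below the single output entry.\<close>
  have "append_cols C C' *\<^sub>v (y @\<^sub>v y') =
      (C *\<^sub>v y + C' *\<^sub>v y') @\<^sub>v (0\<^sub>m 0 m *\<^sub>v y + 0\<^sub>m 0 m' *\<^sub>v y')"
    unfolding append_cols_def dims
    by (rule four_block_mat_mult_vec[OF C zero_carrier_mat zero_carrier_mat y])
  then have "vec_index (append_cols C C' *\<^sub>v (y @\<^sub>v y')) 0 =
      vec_index ((C *\<^sub>v y + C' *\<^sub>v y') @\<^sub>v (0\<^sub>m 0 m *\<^sub>v y + 0\<^sub>m 0 m' *\<^sub>v y')) 0"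
    by (rule arg_cong)
  also have "\<dots> = vec_index (C *\<^sub>v y) 0 + vec_index (C' *\<^sub>v y') 0"
    by (simp add: dims del: index_mult_mat_vec)
  finally show ?thesis
    unfolding three_layer_network_def s_def[symmetric] hidden
    by (simp only: y_def y'_def z_def z'_def)
qed

lemma network_smult_output:
  assumes "C \<in> carrier_mat 1 m" "b \<in> carrier_vec m"
  shows "three_layer_network A b (c \<cdot>\<^sub>m C) t = c * three_layer_network A b C t"
proof -
  define y where "y = map_vec relu (A *\<^sub>v vec_of_list [t] + b)"
  have y: "y \<in> carrier_vec m"
    using carrier_vecD[OF assms(2)] by (intro carrier_vecI) (simp add: y_def)
  have C: "dim_row C = 1" "dim_col C = m"
    using carrier_matD[OF assms(1)] by simp_all
  have "vec_index (c \<cdot>\<^sub>m C *\<^sub>v y) 0 = scalar_prod (c \<cdot>\<^sub>v row C 0) y"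
    by (simp add: C del: smult_scalar_prod_distrib)
  also have "\<dots> = c * scalar_prod (row C 0) y"
    by (rule smult_scalar_prod_distrib[OF _ y]) (simp add: carrier_vecI C)
  also have "scalar_prod (row C 0) y = vec_index (C *\<^sub>v y) 0"
    by (simp add: C)
  finally show ?thesis
    by (simp only: three_layer_network_def y_def)
qed

lemma block_carriers:
  "W2_block x i \<in> carrier_mat 3 1" "b2_block x i \<in> carrier_vec 3" "W3_block \<in> carrier_mat 1 3"
proof -
  have rows: "mat_of_rows_list nc rs \<in> carrier_mat (length rs) nc" for nc and rs :: "real list list"
    unfolding mat_of_rows_list_def by (rule mat_carrier)
  have "length [a, b, c] = 3" "length [d] = 1" for a b c d :: "real list"
    by simp_all
  with rows show "W2_block x i \<in> carrier_mat 3 1" "W3_block \<in> carrier_mat 1 3"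
    unfolding W2_block_def W3_block_def by metis+
  show "b2_block x i \<in> carrier_vec 3"
    unfolding b2_block_def by (rule carrier_vecI) (simp del: vec_of_list_Cons)
qed

definition hat_net :: "(nat \<Rightarrow> real) \<Rightarrow> nat \<Rightarrow> real \<Rightarrow> real" where
  "hat_net x i = three_layer_network (W2_block x i) (b2_block x i) W3_block"

text \<open>The induction over the list of blocks carries the dimensions along, because
  \<open>network_parallel\<close> applies only to conformable blocks. The empty list gives a hidden layer of
  width 0, whose output is an empty sum.\<close>

lemma stacked_network:
  fixes x :: "nat \<Rightarrow> real" and u :: "real \<Rightarrow> real"
  defines "W2 \<equiv> \<lambda>is. foldr append_rows (map (W2_block x) is) (0\<^sub>m 0 1)"
    and "b2 \<equiv> \<lambda>is. foldr append_vec (map (b2_block x) is) (0\<^sub>v 0)"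
    and "W3 \<equiv> \<lambda>is. foldr append_cols (map (\<lambda>i. u (x i) \<cdot>\<^sub>m W3_block) is) (0\<^sub>m 1 0)"
  shows "W2 is \<in> carrier_mat (3 * length is) 1 \<and> b2 is \<in> carrier_vec (3 * length is) \<and>
    W3 is \<in> carrier_mat 1 (3 * length is) \<and>
    three_layer_network (W2 is) (b2 is) (W3 is) t = (\<Sum>i\<leftarrow>is. u (x i) * hat_net x i t)"
proof (induction "is")
  case Nil
  show ?case
    by (simp add: W2_def b2_def W3_def three_layer_network_def scalar_prod_def)
next
  case (Cons i js)
  have C: "u (x i) \<cdot>\<^sub>m W3_block \<in> carrier_mat 1 3"
    using block_carriers by simp
  have eq: "W2 (i # js) = W2_block x i @\<^sub>r W2 js" "b2 (i # js) = b2_block x i @\<^sub>v b2 js"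
    "W3 (i # js) = append_cols (u (x i) \<cdot>\<^sub>m W3_block) (W3 js)"
    by (simp_all add: W2_def b2_def W3_def)
  have "W2_block x i @\<^sub>r W2 js \<in> carrier_mat (3 + 3 * length js) 1"
    using Cons.IH block_carriers by (intro carrier_append_rows) auto
  moreover have "b2_block x i @\<^sub>v b2 js \<in> carrier_vec (3 + 3 * length js)"
    using Cons.IH block_carriers by (intro append_carrier_vec) auto
  moreover have "append_cols (u (x i) \<cdot>\<^sub>m W3_block) (W3 js) \<in> carrier_mat (1 + 0) (3 + 3 * length js)"
    unfolding append_cols_def using Cons.IH C by (intro four_block_carrier_mat) auto
  moreover have "three_layer_network (W2 (i # js)) (b2 (i # js)) (W3 (i # js)) t =
      u (x i) * hat_net x i t + three_layer_network (W2 js) (b2 js) (W3 js) t"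
    unfolding eq using Cons.IH C block_carriers
    by (subst network_parallel[where m=3 and m'="3 * length js"])
      (auto simp: hat_net_def network_smult_output[OF block_carriers(3,2)])
  ultimately show ?case
    using Cons.IH by (simp add: eq)
qed

section \<open>The network of one block is a hat function\<close>

lemma three_neuron_network:
  "three_layer_network (mat_of_rows_list 1 [[a\<^sub>0], [a\<^sub>1], [a\<^sub>2]]) (vec_of_list [b\<^sub>0, b\<^sub>1, b\<^sub>2])
      (mat_of_rows_list 3 [[c\<^sub>0, c\<^sub>1, c\<^sub>2]]) t
    = c\<^sub>0 * relu (a\<^sub>0 * t + b\<^sub>0) + c\<^sub>1 * relu (a\<^sub>1 * t + b\<^sub>1) + c\<^sub>2 * relu (a\<^sub>2 * t + b\<^sub>2)"
proof -
  define as bs cs where "as = [[a\<^sub>0], [a\<^sub>1], [a\<^sub>2]]" and "bs = [b\<^sub>0, b\<^sub>1, b\<^sub>2]" and "cs = [[c\<^sub>0, c\<^sub>1, c\<^sub>2]]"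
  have len: "length as = 3" "length bs = 3" "length cs = 1"
    by (simp_all add: as_def bs_def cs_def)
  have s: "dim_vec (vec_of_list [t]) = 1" "vec_index (vec_of_list [t]) 0 = t"
    by simp_all
  define y where "y = map_vec relu (mat_of_rows_list 1 as *\<^sub>v vec_of_list [t] + vec_of_list bs)"
  have y: "dim_vec y = 3" by (simp add: y_def len del: vec_of_list_Cons)
  have yi: "vec_index y i = relu (as ! i ! 0 * t + bs ! i)" if "i < 3" for i
    using that s unfolding y_def mat_of_rows_list_def
    by (simp add: len scalar_prod_def vec_of_list_index del: vec_of_list_Cons)
  have "vec_index (mat_of_rows_list 3 cs *\<^sub>v y) 0 = (\<Sum>i = 0..<3. cs ! 0 ! i * vec_index y i)"
    unfolding mat_of_rows_list_def by (simp add: len scalar_prod_def y)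
  also have "\<dots> = (\<Sum>i = 0..<3. cs ! 0 ! i * relu (as ! i ! 0 * t + bs ! i))"
    by (intro sum.cong refl) (simp add: yi)
  also have "\<dots> = c\<^sub>0 * relu (a\<^sub>0 * t + b\<^sub>0) + c\<^sub>1 * relu (a\<^sub>1 * t + b\<^sub>1) + c\<^sub>2 * relu (a\<^sub>2 * t + b\<^sub>2)"
    by (simp add: as_def bs_def cs_def numeral_3_eq_3)
  finally show ?thesis
    by (simp only: three_layer_network_def y_def as_def bs_def cs_def)
qed

lemma hat_net_eq:
  "hat_net x i t = relu ((t - x (i - 1)) / mesh x (i - 1))
     - relu ((t - x i) * (1 / mesh x (i - 1) + 1 / mesh x i)) + relu ((t - x (i + 1)) / mesh x i)"
proof -
  have arg: "1 / d * t + - a / d = (t - a) / d" for a d :: real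
    by (simp add: diff_divide_distrib)
  have arg': "c * t + - a * c = (t - a) * c" for a c :: real
    by (simp add: algebra_simps)
  show ?thesis
    unfolding hat_net_def W2_block_def b2_block_def W3_block_def three_neuron_network arg arg'
    by simp
qed

section \<open>Hat functions on the cells of the partition\<close>

lemma partition_mono:
  assumes "is_partition N x" "i \<le> j" "j \<le> N"
  shows "x i \<le> x j"
  using assms(2,3)
proof (induction j rule: dec_induct)
  case (step n)
  then have "x n < x (n + 1)" using assms(1) by (simp add: is_partition_def)
  then show ?case using step by simp
qed simp

lemma partition_cell:
  assumes "is_partition N x" "N > 0" "t \<in> {0..1}"
  obtains j where "j < N" "t \<in> {x j..x (j + 1)}"
proof -
  define j where "j = (LEAST k. t \<le> x (k + 1))"
  have N: "t \<le> x (N - 1 + 1)" using assms by (simp add: is_partition_def)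
  have "t \<le> x (j + 1)" unfolding j_def using N by (rule LeastI)
  moreover have "j \<le> N - 1" unfolding j_def using N by (rule Least_le)
  moreover have "x j \<le> t"
  proof (cases j)
    case 0
    then show ?thesis using assms by (simp add: is_partition_def)
  next
    case (Suc k)
    then have "\<not> t \<le> x (k + 1)" unfolding j_def using not_less_Least[of k] by (metis lessI)
    then show ?thesis using Suc by simp
  qed
  ultimately show ?thesis using that[of j] assms(2) by auto
qed

text \<open>Left of \<open>x (i - 1)\<close> no neuron is active. The first one produces the rising flank; the
  second turns the slope \<open>1 / h\<close> into \<open>-1 / h'\<close> at \<open>x i\<close>, giving the falling flank, which meets 0
  at \<open>x (i + 1)\<close>; from there on the third cancels the remaining slope, so that the sum of all
  three vanishes identically. Thus on the cell \<open>j\<close> only the hats of its two end points survive.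
  The right-hand side is a sum of two conditionals so that a sum over \<open>i\<close> collapses.\<close>

lemma hat_net_on_cell:
  assumes P: "is_partition N x" and i: "i \<in> {1..<N}" and j: "j < N" and t: "t \<in> {x j..x (j + 1)}"
  shows "hat_net x i t = (if i = j then (x (j + 1) - t) / mesh x j else 0)
    + (if i = j + 1 then (t - x j) / mesh x j else 0)"
proof -
  obtain k where k: "i = Suc k" using i by (cases i) auto
  have h: "mesh x k > 0" "mesh x i > 0"
    using P i k by (auto simp: mesh_def is_partition_def)
  \<comment> \<open>A positive factor does not move the kink, so each neuron switches on exactly at its node.\<close>
  have kink: "relu ((t - a) / d) = (if a \<le> t then (t - a) / d else 0)"
    "relu ((t - a) * d) = (if a \<le> t then (t - a) * d else 0)" if "d > 0" for a d
    using that by (auto simp: relu_def zero_le_divide_iff zero_le_mult_iff)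
  have d: "1 / mesh x k + 1 / mesh x i > 0" using h by (simp add: add_pos_pos)
  have hat: "hat_net x i t = (if x k \<le> t then (t - x k) / mesh x k else 0)
     - (if x i \<le> t then (t - x i) * (1 / mesh x k + 1 / mesh x i) else 0)
     + (if x (i + 1) \<le> t then (t - x (i + 1)) / mesh x i else 0)"
    using kink(1)[OF h(1)] kink(1)[OF h(2)] kink(2)[OF d] by (simp add: hat_net_eq k)
  have xi: "x i = x k + mesh x k" "x (i + 1) = x i + mesh x i"
    by (simp_all add: mesh_def k)
  consider "i > j + 1" | "i = j + 1" | "i = j" | "i < j" by linarith
  then show ?thesis
  proof cases
    case 1
    then have "x (j + 1) \<le> x k" using P i k by (intro partition_mono[of N]) auto
    then have "t \<le> x k" using t by auto
    then show ?thesis using 1 h xi unfolding hat by auto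
  next
    case 2
    then have "j = k" using k by simp
    then have "x k \<le> t" "t \<le> x i" using t 2 by auto
    then show ?thesis using 2 h xi \<open>j = k\<close> unfolding hat by auto
  next
    case 3
    then have "x i \<le> t" "t \<le> x (i + 1)" using t by auto
    then have "hat_net x i t = (t - x k) / mesh x k - (t - x i) * (1 / mesh x k + 1 / mesh x i)"
      using h xi unfolding hat by auto
    also have "\<dots> = (x (i + 1) - t) / mesh x i"
      using h xi by (simp add: field_simps)
    finally show ?thesis using 3 by simp
  next
    case 4
    then have "x (i + 1) \<le> x j" using P j by (intro partition_mono[of N]) auto
    then have t': "x (i + 1) \<le> t" using t by auto
    then have "hat_net x i t = (t - x k) / mesh x k
        - (t - x i) * (1 / mesh x k + 1 / mesh x i) + (t - x (i + 1)) / mesh x i"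
      using h xi unfolding hat by auto
    also have "\<dots> = 0"
      using h xi by (simp add: field_simps)
    finally show ?thesis using 4 by simp
  qed
qed

section \<open>Finite element functions are sums of hats\<close>

lemma fem_space_interpolation:
  assumes P: "is_partition N x" and u: "u \<in> fem_space N x" and j: "j < N" and t: "t \<in> {x j..x (j + 1)}"
  shows "u t = u (x j) * ((x (j + 1) - t) / mesh x j) + u (x (j + 1)) * ((t - x j) / mesh x j)"
proof -
  obtain a b where ab: "\<And>s. s \<in> {x j..x (j + 1)} \<Longrightarrow> u s = a * s + b"
    using u j by (auto simp: fem_space_def)
  have less: "x j < x (j + 1)" using P j by (simp add: is_partition_def)
  then have "u t = a * t + b" "u (x j) = a * x j + b" "u (x (j + 1)) = a * x (j + 1) + b"
    using ab t by auto
  then show ?thesis using less by (simp add: mesh_def divide_simps) (simp add: algebra_simps)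
qed

text \<open>On each cell both sides are the linear interpolant of the values at the end points of the
  cell. An end point that is a boundary node has no hat in the sum; the boundary condition
  makes its term vanish on the other side too.\<close>

lemma sum_hat_net_eq:
  assumes P: "is_partition N x" and N: "N > 0" and u: "u \<in> fem_space N x" and t: "t \<in> {0..1}"
  shows "(\<Sum>i=1..<N. u (x i) * hat_net x i t) = u t"
proof -
  obtain j where j: "j < N" "t \<in> {x j..x (j + 1)}" using partition_cell[OF P N t] .
  let ?l = "(x (j + 1) - t) / mesh x j" and ?r = "(t - x j) / mesh x j"
  have bdry: "u (x 0) = 0" "u (x N) = 0"
    using P u by (auto simp: is_partition_def fem_space_def)
  have "(\<Sum>i=1..<N. u (x i) * hat_net x i t) =
      (\<Sum>i=1..<N. (if i = j then u (x j) * ?l else 0) + (if i = j + 1 then u (x (j + 1)) * ?r else 0))"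
    by (intro sum.cong refl) (simp add: hat_net_on_cell[OF P _ j] distrib_left)
  also have "\<dots> = (if j \<in> {1..<N} then u (x j) * ?l else 0)
      + (if j + 1 \<in> {1..<N} then u (x (j + 1)) * ?r else 0)"
    by (simp only: sum.distrib sum.delta' sum.delta finite_atLeastLessThan)
  also have "\<dots> = u (x j) * ?l + u (x (j + 1)) * ?r"
  proof -
    have "u (x j) = 0" if "j \<notin> {1..<N}" using that j bdry by (cases j) auto
    moreover have "u (x (j + 1)) = 0" if "j + 1 \<notin> {1..<N}"
    proof -
      have "j + 1 = N" using that j by auto
      then show ?thesis using bdry by simp
    qed
    ultimately show ?thesis by auto
  qed
  also have "\<dots> = u t" using fem_space_interpolation[OF P u j] by simp
  finally show ?thesis .
qed

theorem proposition1:
  fixes \<epsilon> :: real and N :: nat and x :: "nat \<Rightarrow> real" and u\<^sub>h :: "real \<Rightarrow> real"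
  assumes "\<epsilon> > 0"
    and "N > 0"
    and "is_partition N x"
    and "galerkin_solution \<epsilon> N x u\<^sub>h"
  shows "\<forall>t\<in>{0..1}. three_layer_network (W2_mat N x) (b2_vec N x) (W3_mat N x u\<^sub>h) t = u\<^sub>h t"
proof
  fix t :: real
  assume t: "t \<in> {0..1}"
  have u: "u\<^sub>h \<in> fem_space N x" using assms(4) by (simp add: galerkin_solution_def)
  have "three_layer_network (W2_mat N x) (b2_vec N x) (W3_mat N x u\<^sub>h) t =
      (\<Sum>i\<leftarrow>[1..<N]. u\<^sub>h (x i) * hat_net x i t)"
    using stacked_network[of x "[1..<N]" u\<^sub>h t] by (simp add: W2_mat_def b2_vec_def W3_mat_def)
  also have "\<dots> = (\<Sum>i=1..<N. u\<^sub>h (x i) * hat_net x i t)"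
    by (simp add: interv_sum_list_conv_sum_set_nat)
  also have "\<dots> = u\<^sub>h t" using sum_hat_net_eq[OF assms(3,2) u t] .
  finally show "three_layer_network (W2_mat N x) (b2_vec N x) (W3_mat N x u\<^sub>h) t = u\<^sub>h t" .
qed

end
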